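(* Let $\mathcal{P}$ be a Poisson algebra over an arbitrary field $K$. Then the following statements are equivalent: (1) The algebra $P\mathcal{D}(\mathcal{P})$ of Poisson differential operators on $\mathcal{P}$ is a simple algebra. (2) The Poisson algebra $\mathcal{P}$ is a Poisson simple algebra.
   Context: A Poisson algebra over $K$ is a commutative associative (unital) $K$-algebra $\mathcal{P}$ with a $K$-bilinear Lie bracket $\{\cdot,\cdot\}$ such that $\{a,xy\}=\{a,x\}y+x\{a,y\}$ for all $a,x,y\in\mathcal{P}$. A Poisson ideal is an ideal $J$ of the associative algebra $\mathcal{P}$ with $\{\mathcal{P},J\}\subseteq J$; $\mathcal{P}$ is Poisson simple if $0$ and $\mathcal{P}$ are its only Poisson ideals. For $a\in\mathcal{P}$ let $\mathrm{pad}_a=\{a,\cdot\}\in \mathrm{Der}_K(\mathcal{P})$. The algebra $P\mathcal{D}(\mathcal{P})$ of Poisson differential operators is the subalgebra of $\mathrm{End}_K(\mathcal{P})$ generated by the multiplication operators $b\mapsto ab$ ($a\in\mathcal{P}$) and by all $\mathrm{pad}_a$ ($a\in\mathcal{P}$). A simple algebra is one whose only two-sided ideals are $0$ and itself. *)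

theory Defs
  imports "HOL-Algebra.Module" "HOL-Algebra.Ideal" "HOL-Algebra.Subrings"
begin

section \<open>Associative algebras\<close>

text \<open>The library locale \<^locale>\<open>algebra\<close> is commutative; this is its not necessarily
  commutative counterpart.  Algebras are unital, and the zero algebra is not excluded.\<close>

locale assoc_algebra = module R M + A?: ring M for R (structure) and M (structure) +
  assumes smult_mult_left:
      "\<lbrakk> a \<in> carrier R; x \<in> carrier M; y \<in> carrier M \<rbrakk> \<Longrightarrow>
        (a \<odot>\<^bsub>M\<^esub> x) \<otimes>\<^bsub>M\<^esub> y = a \<odot>\<^bsub>M\<^esub> (x \<otimes>\<^bsub>M\<^esub> y)"
    and smult_mult_right:
      "\<lbrakk> a \<in> carrier R; x \<in> carrier M; y \<in> carrier M \<rbrakk> \<Longrightarrow>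
        x \<otimes>\<^bsub>M\<^esub> (a \<odot>\<^bsub>M\<^esub> y) = a \<odot>\<^bsub>M\<^esub> (x \<otimes>\<^bsub>M\<^esub> y)"

text \<open>Ring ideals suffice here: since \<open>A\<close> has a unit, every two-sided ideal is a
  \<open>K\<close>-subspace, because \<open>c \<odot> x = (c \<odot> \<one>) \<otimes> x\<close>.\<close>

definition simple_algebra ::
  "('k, 'm) ring_scheme \<Rightarrow> ('k, 'a, 'n) module_scheme \<Rightarrow> bool" where
  "simple_algebra K A \<longleftrightarrow>
     assoc_algebra K A \<and> (\<forall>I. ideal I A \<longrightarrow> I = {\<zero>\<^bsub>A\<^esub>} \<or> I = carrier A)"

definition is_subalgebra ::
  "'a set \<Rightarrow> ('k, 'm) ring_scheme \<Rightarrow> ('k, 'a, 'n) module_scheme \<Rightarrow> bool" where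
  "is_subalgebra B K A \<longleftrightarrow> subring B A \<and> submodule B K A"

definition generated_subalgebra ::
  "('k, 'm) ring_scheme \<Rightarrow> ('k, 'a, 'n) module_scheme \<Rightarrow> 'a set \<Rightarrow> 'a set" where
  "generated_subalgebra K A S = \<Inter> {B. is_subalgebra B K A \<and> S \<subseteq> B}"

section \<open>The endomorphism algebra of a module\<close>

text \<open>Endomorphisms are \<open>K\<close>-linear maps on the carrier, made extensional (undefined outside
  the carrier) so that HOL equality is equality of maps.\<close>

definition End_algebra ::
  "('k, 'm) ring_scheme \<Rightarrow> ('k, 'p, 'n) module_scheme \<Rightarrow> ('k, 'p \<Rightarrow> 'p) module" where
  "End_algebra K V = \<lparr>
     carrier = {f \<in> carrier V \<rightarrow>\<^sub>E carrier V.
        (\<forall>x\<in>carrier V. \<forall>y\<in>carrier V. f (x \<oplus>\<^bsub>V\<^esub> y) = f x \<oplus>\<^bsub>V\<^esub> f y) \<and>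
        (\<forall>c\<in>carrier K. \<forall>x\<in>carrier V. f (c \<odot>\<^bsub>V\<^esub> x) = c \<odot>\<^bsub>V\<^esub> f x)},
     monoid.mult = compose (carrier V),
     one = (\<lambda>x\<in>carrier V. x),
     ring.zero = (\<lambda>x\<in>carrier V. \<zero>\<^bsub>V\<^esub>),
     add = (\<lambda>f g. \<lambda>x\<in>carrier V. f x \<oplus>\<^bsub>V\<^esub> g x),
     smult = (\<lambda>c f. \<lambda>x\<in>carrier V. c \<odot>\<^bsub>V\<^esub> f x) \<rparr>"

section \<open>Poisson algebras\<close>

locale poisson_algebra = K?: field K + P?: algebra K P
  for K :: "('k, 'm) ring_scheme" (structure) and P :: "('k, 'p, 'n) module_scheme" (structure) +
  fixes br :: "'p \<Rightarrow> 'p \<Rightarrow> 'p"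
  assumes br_closed:
      "\<lbrakk> x \<in> carrier P; y \<in> carrier P \<rbrakk> \<Longrightarrow> br x y \<in> carrier P"
    and br_add_left:
      "\<lbrakk> x \<in> carrier P; y \<in> carrier P; z \<in> carrier P \<rbrakk> \<Longrightarrow>
        br (x \<oplus>\<^bsub>P\<^esub> y) z = br x z \<oplus>\<^bsub>P\<^esub> br y z"
    and br_add_right:
      "\<lbrakk> x \<in> carrier P; y \<in> carrier P; z \<in> carrier P \<rbrakk> \<Longrightarrow>
        br x (y \<oplus>\<^bsub>P\<^esub> z) = br x y \<oplus>\<^bsub>P\<^esub> br x z"
    and br_smult_left:
      "\<lbrakk> c \<in> carrier K; x \<in> carrier P; y \<in> carrier P \<rbrakk> \<Longrightarrow>
        br (c \<odot>\<^bsub>P\<^esub> x) y = c \<odot>\<^bsub>P\<^esub> br x y"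
    and br_smult_right:
      "\<lbrakk> c \<in> carrier K; x \<in> carrier P; y \<in> carrier P \<rbrakk> \<Longrightarrow>
        br x (c \<odot>\<^bsub>P\<^esub> y) = c \<odot>\<^bsub>P\<^esub> br x y"
    and br_self:
      "x \<in> carrier P \<Longrightarrow> br x x = \<zero>\<^bsub>P\<^esub>"
    and br_jacobi:
      "\<lbrakk> x \<in> carrier P; y \<in> carrier P; z \<in> carrier P \<rbrakk> \<Longrightarrow>
        br x (br y z) \<oplus>\<^bsub>P\<^esub> br y (br z x) \<oplus>\<^bsub>P\<^esub> br z (br x y) = \<zero>\<^bsub>P\<^esub>"
    and br_leibniz:
      "\<lbrakk> a \<in> carrier P; x \<in> carrier P; y \<in> carrier P \<rbrakk> \<Longrightarrow>
        br a (x \<otimes>\<^bsub>P\<^esub> y) = br a x \<otimes>\<^bsub>P\<^esub> y \<oplus>\<^bsub>P\<^esub> x \<otimes>\<^bsub>P\<^esub> br a y"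

definition poisson_ideal ::
  "'p set \<Rightarrow> ('p, 'n) ring_scheme \<Rightarrow> ('p \<Rightarrow> 'p \<Rightarrow> 'p) \<Rightarrow> bool" where
  "poisson_ideal J P br \<longleftrightarrow> ideal J P \<and> (\<forall>a\<in>carrier P. \<forall>x\<in>J. br a x \<in> J)"

definition poisson_simple :: "('p, 'n) ring_scheme \<Rightarrow> ('p \<Rightarrow> 'p \<Rightarrow> 'p) \<Rightarrow> bool" where
  "poisson_simple P br \<longleftrightarrow> (\<forall>J. poisson_ideal J P br \<longrightarrow> J = {\<zero>\<^bsub>P\<^esub>} \<or> J = carrier P)"

definition mult_op :: "('p, 'n) ring_scheme \<Rightarrow> 'p \<Rightarrow> 'p \<Rightarrow> 'p" where
  "mult_op P a = (\<lambda>x\<in>carrier P. a \<otimes>\<^bsub>P\<^esub> x)"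

definition pad :: "('p, 'n) ring_scheme \<Rightarrow> ('p \<Rightarrow> 'p \<Rightarrow> 'p) \<Rightarrow> 'p \<Rightarrow> 'p \<Rightarrow> 'p" where
  "pad P br a = (\<lambda>x\<in>carrier P. br a x)"

definition poisson_diff_ops ::
  "('k, 'm) ring_scheme \<Rightarrow> ('k, 'p, 'n) module_scheme \<Rightarrow> ('p \<Rightarrow> 'p \<Rightarrow> 'p)
     \<Rightarrow> ('k, 'p \<Rightarrow> 'p) module" where
  "poisson_diff_ops K P br =
     (End_algebra K P)\<lparr>carrier :=
        generated_subalgebra K (End_algebra K P)
          (mult_op P ` carrier P \<union> pad P br ` carrier P)\<rparr>"

section \<open>Well-definedness\<close>

lemma assoc_algebra_End:
  assumes "module K V"
  shows "assoc_algebra K (End_algebra K V)"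
proof -
  interpret V: module K V by fact
  let ?E = "End_algebra K V"
  have neg: "\<exists>g\<in>carrier ?E. g \<oplus>\<^bsub>?E\<^esub> f = \<zero>\<^bsub>?E\<^esub>" if f: "f \<in> carrier ?E" for f
  proof
    show "(\<lambda>x\<in>carrier V. \<ominus>\<^bsub>V\<^esub> f x) \<in> carrier ?E"
      using f by (auto simp: End_algebra_def PiE_iff V.minus_add V.smult_r_minus)
    show "(\<lambda>x\<in>carrier V. \<ominus>\<^bsub>V\<^esub> f x) \<oplus>\<^bsub>?E\<^esub> f = \<zero>\<^bsub>?E\<^esub>"
      using f by (auto simp: End_algebra_def PiE_iff V.l_neg intro!: restrict_ext)
  qed
  have grp: "abelian_group ?E"
    by (rule abelian_groupI)
       (use neg in \<open>auto simp: End_algebra_def PiE_iff V.a_ac V.smult_r_distr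
          intro!: extensionalityI[where A = "carrier V"]\<close>)
  have rng: "ring ?E"
    by (rule ringI[OF grp])
       (auto intro!: monoidI simp: End_algebra_def PiE_iff compose_def
          intro!: extensionalityI[where A = "carrier V"])
  have mdl: "module K ?E"
  proof (rule moduleI[OF V.R.is_cring grp])
    show "c \<odot>\<^bsub>?E\<^esub> f \<in> carrier ?E" if "c \<in> carrier K" "f \<in> carrier ?E" for c f
    proof -
      have "c \<odot>\<^bsub>V\<^esub> (d \<odot>\<^bsub>V\<^esub> f x) = d \<odot>\<^bsub>V\<^esub> (c \<odot>\<^bsub>V\<^esub> f x)"
        if "d \<in> carrier K" "x \<in> carrier V" for d x
        using that \<open>c \<in> carrier K\<close> \<open>f \<in> carrier ?E\<close>
        by (simp add: End_algebra_def PiE_iff V.R.m_comm V.smult_assoc1[symmetric])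
      then show ?thesis
        using that by (auto simp: End_algebra_def PiE_iff V.smult_r_distr)
    qed
  qed (auto simp: End_algebra_def PiE_iff V.smult_r_distr V.smult_l_distr V.smult_assoc1
          intro!: extensionalityI[where A = "carrier V"])
  show ?thesis
    by (intro assoc_algebra.intro mdl rng assoc_algebra_axioms.intro)
       (auto simp: End_algebra_def PiE_iff compose_def
          intro!: extensionalityI[where A = "carrier V"])
qed

lemma generated_subalgebra_is_subalgebra:
  assumes "assoc_algebra K A" and S: "S \<subseteq> carrier A"
  shows "is_subalgebra (generated_subalgebra K A S) K A"
proof -
  interpret A: assoc_algebra K A by fact
  let ?F = "{B. is_subalgebra B K A \<and> S \<subseteq> B}"
  have ne: "?F \<noteq> {}"
    using A.A.carrier_is_subring A.carrier_is_submodule S unfolding is_subalgebra_def by blast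
  have sr: "subring (\<Inter> ?F) A"
    by (rule A.A.subring_Inter) (use ne in \<open>auto simp: is_subalgebra_def\<close>)
  have "submodule (\<Inter> ?F) K A"
  proof (rule A.submoduleI)
    fix c x assume c: "c \<in> carrier K" and x: "x \<in> \<Inter> ?F"
    show "c \<odot>\<^bsub>A\<^esub> x \<in> \<Inter> ?F"
    proof (rule InterI)
      fix B assume B: "B \<in> ?F"
      then have "submodule B K A" by (simp add: is_subalgebra_def)
      moreover have "x \<in> B" using x B by (rule InterD)
      ultimately show "c \<odot>\<^bsub>A\<^esub> x \<in> B" using c by (intro submodule.smult_closed)
    qed
  qed (fact subringE(1)[OF sr] subringE(2)[OF sr] subringE(5)[OF sr] subringE(7)[OF sr])+
  with sr show ?thesis
    unfolding generated_subalgebra_def by (simp add: is_subalgebra_def)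
qed

lemma (in poisson_algebra) poisson_generators_closed:
  "mult_op P ` carrier P \<union> pad P br ` carrier P \<subseteq> carrier (End_algebra K P)"
proof -
  have "a \<otimes>\<^bsub>P\<^esub> (c \<odot>\<^bsub>P\<^esub> x) = c \<odot>\<^bsub>P\<^esub> (a \<otimes>\<^bsub>P\<^esub> x)"
    if "a \<in> carrier P" "c \<in> carrier K" "x \<in> carrier P" for a c x
    using that by (simp add: P.m_comm[of a] P.smult_assoc2)
  then show ?thesis
    by (auto simp: End_algebra_def mult_op_def pad_def br_closed br_add_right br_smult_right
        P.r_distr)
qed

lemma (in poisson_algebra) assoc_algebra_poisson_diff_ops:
  "assoc_algebra K (poisson_diff_ops K P br)"
proof -
  let ?E = "End_algebra K P"
  let ?B = "generated_subalgebra K ?E (mult_op P ` carrier P \<union> pad P br ` carrier P)"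
  interpret E: assoc_algebra K ?E
    by (rule assoc_algebra_End) (rule module)
  have B: "subring ?B ?E" "submodule ?B K ?E"
    using generated_subalgebra_is_subalgebra[OF E.assoc_algebra_axioms poisson_generators_closed]
    by (auto simp: is_subalgebra_def)
  have "module K (?E\<lparr>carrier := ?B\<rparr>)"
    using submodule.submodule_is_module[OF B(2)] E.module_axioms by blast
  moreover have "ring (?E\<lparr>carrier := ?B\<rparr>)"
    using E.A.subring_is_ring[OF B(1)] .
  ultimately show ?thesis
    unfolding poisson_diff_ops_def
    by (intro assoc_algebra.intro assoc_algebra_axioms.intro)
       (use subringE(1)[OF B(1)] in \<open>auto simp: E.smult_mult_left E.smult_mult_right subset_iff\<close>)
qed

end

theory Submission
  imports Defs
begin

text \<open>A nonzero proper Poisson ideal \<open>J\<close> yields the nonzero proper two-sided ideal of operators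
  with image in \<open>J\<close>.  Conversely, Poisson differential operators are differential operators, so
  taking commutators with multiplications repeatedly turns any nonzero operator of a two-sided ideal
  \<open>I\<close> into a nonzero operator of \<open>I\<close> commuting with all multiplications, that is, into a
  multiplication.  The elements whose multiplication operator lies in \<open>I\<close> form a Poisson ideal
  because \<open>[pad b, a] = {b, a}\<close>, so Poisson simplicity puts the identity into \<open>I\<close>.\<close>

section \<open>Commutators in a noncommutative ring\<close>

definition commutator :: "('a, 'm) ring_scheme \<Rightarrow> 'a \<Rightarrow> 'a \<Rightarrow> 'a" where
  "commutator R f c = f \<otimes>\<^bsub>R\<^esub> c \<ominus>\<^bsub>R\<^esub> c \<otimes>\<^bsub>R\<^esub> f"

text \<open>The elements killed by finitely many commutators with \<open>C\<close>: Grothendieck's differential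
  operators when \<open>C\<close> consists of the multiplications.  Well-founded induction on this set
  replaces induction on the order of an operator.\<close>

inductive_set diff_elems :: "('a, 'm) ring_scheme \<Rightarrow> 'a set \<Rightarrow> 'a set"
  for R :: "('a, 'm) ring_scheme" and C :: "'a set" where
  zero: "\<zero>\<^bsub>R\<^esub> \<in> diff_elems R C"
| step: "\<lbrakk> f \<in> carrier R; \<And>c. c \<in> C \<Longrightarrow> commutator R f c \<in> diff_elems R C \<rbrakk>
          \<Longrightarrow> f \<in> diff_elems R C"

context ring
begin

lemma commutator_closed:
  "\<lbrakk> f \<in> carrier R; c \<in> carrier R \<rbrakk> \<Longrightarrow> commutator R f c \<in> carrier R"
  by (simp add: commutator_def)

text \<open>Trades subtraction for addition, so that the identities below reduce to sums that
  associativity and commutativity can match.\<close>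

lemma commutator_eq_iff:
  assumes "f \<in> carrier R" "c \<in> carrier R" "d \<in> carrier R"
  shows "commutator R f c = d \<longleftrightarrow> f \<otimes> c = d \<oplus> c \<otimes> f"
proof
  assume "commutator R f c = d"
  then have "d \<oplus> c \<otimes> f = (f \<otimes> c \<ominus> c \<otimes> f) \<oplus> c \<otimes> f" by (simp add: commutator_def)
  then show "f \<otimes> c = d \<oplus> c \<otimes> f" using assms by (simp add: a_minus_def a_assoc l_neg)
next
  assume "f \<otimes> c = d \<oplus> c \<otimes> f"
  then show "commutator R f c = d"
    using assms by (simp add: commutator_def a_minus_def a_assoc r_neg)
qed

lemma commutator_swap:
  "\<lbrakk> f \<in> carrier R; c \<in> carrier R \<rbrakk> \<Longrightarrow> f \<otimes> c = commutator R f c \<oplus> c \<otimes> f"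
  using commutator_eq_iff commutator_closed by blast

lemma commutator_add:
  assumes "f \<in> carrier R" "g \<in> carrier R" "c \<in> carrier R"
  shows "commutator R (f \<oplus> g) c = commutator R f c \<oplus> commutator R g c"
  using assms
  by (subst commutator_eq_iff)
     (auto simp: commutator_closed l_distr r_distr commutator_swap[of f] commutator_swap[of g] a_ac)

text \<open>Move \<open>c\<close> to the left past \<open>g\<close> and then past \<open>f\<close>.
  This Leibniz rule drives the closure of \<open>diff_elems\<close> under products.\<close>

lemma commutator_mult:
  assumes "f \<in> carrier R" "g \<in> carrier R" "c \<in> carrier R"
  shows "commutator R (f \<otimes> g) c = f \<otimes> commutator R g c \<oplus> commutator R f c \<otimes> g"
proof -
  have "f \<otimes> g \<otimes> c = f \<otimes> (commutator R g c \<oplus> c \<otimes> g)"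
    using assms by (simp add: m_assoc commutator_swap[of g])
  also have "\<dots> = f \<otimes> commutator R g c \<oplus> (commutator R f c \<oplus> c \<otimes> f) \<otimes> g"
    using assms by (simp add: commutator_closed r_distr m_assoc[symmetric] commutator_swap[of f])
  finally show ?thesis
    using assms by (subst commutator_eq_iff) (auto simp: commutator_closed l_distr m_assoc a_assoc)
qed

lemma commutator_eq_zero_iff:
  "\<lbrakk> f \<in> carrier R; c \<in> carrier R \<rbrakk> \<Longrightarrow> commutator R f c = \<zero> \<longleftrightarrow> f \<otimes> c = c \<otimes> f"
  by (simp add: commutator_eq_iff)

text \<open>Closure under negatives comes for free, since \<open>\<ominus> x\<close> is the product
  of \<open>\<ominus> \<one>\<close> and \<open>x\<close>.\<close>

lemma idealI_unital:
  assumes "I \<subseteq> carrier R" "\<zero> \<in> I" "\<And>x y. \<lbrakk> x \<in> I; y \<in> I \<rbrakk> \<Longrightarrow> x \<oplus> y \<in> I"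
    and left: "\<And>x y. \<lbrakk> x \<in> I; y \<in> carrier R \<rbrakk> \<Longrightarrow> y \<otimes> x \<in> I"
    and right: "\<And>x y. \<lbrakk> x \<in> I; y \<in> carrier R \<rbrakk> \<Longrightarrow> x \<otimes> y \<in> I"
  shows "ideal I R"
proof (rule idealI[OF ring_axioms])
  have "\<ominus> x \<in> I" if "x \<in> I" for x
    using left[OF that, of "\<ominus> \<one>"] that assms(1) by (auto simp: l_minus)
  then show "subgroup I (add_monoid R)"
    using assms(1-3) by (intro add.subgroupI) auto
qed (fact left right)+

lemma ideal_commutator:
  assumes "ideal I R" "f \<in> I" "c \<in> carrier R"
  shows "commutator R f c \<in> I" "commutator R c f \<in> I"
proof -
  interpret ideal I R by fact
  show "commutator R f c \<in> I" "commutator R c f \<in> I"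
    using assms I_l_closed[of f c] I_r_closed[of f c]
    by (auto simp: commutator_def a_minus_def intro!: a_closed a_inv_closed)
qed

section \<open>Elements killed by iterated commutators\<close>

lemma diff_elems_closed: "f \<in> diff_elems R C \<Longrightarrow> f \<in> carrier R"
  by (induction rule: diff_elems.induct) auto

lemma diff_elems_commutator:
  assumes "f \<in> diff_elems R C" "C \<subseteq> carrier R" "c \<in> C"
  shows "commutator R f c \<in> diff_elems R C"
  using assms(1)
proof cases
  case zero
  then show ?thesis
    using assms by (auto simp: commutator_def a_minus_def subset_iff intro: diff_elems.zero)
qed (use assms in auto)

text \<open>The base of the hierarchy: all commutators vanish after one step. It supplies the unit,
  its negative, the scalars and the multiplication operators.\<close>

lemma diff_elems_commuting:
  assumes "f \<in> carrier R" "C \<subseteq> carrier R" "\<And>c. c \<in> C \<Longrightarrow> f \<otimes> c = c \<otimes> f"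
  shows "f \<in> diff_elems R C"
proof (rule diff_elems.step)
  fix c assume "c \<in> C"
  then have "commutator R f c = \<zero>" using assms by (subst commutator_eq_zero_iff) auto
  then show "commutator R f c \<in> diff_elems R C" by (simp add: diff_elems.zero)
qed fact

text \<open>Taking a commutator is additive and changes both summands at once, hence the induction
  on \<open>f\<close> with \<open>g\<close> arbitrary.\<close>

lemma diff_elems_add:
  assumes "f \<in> diff_elems R C" "g \<in> diff_elems R C" and C: "C \<subseteq> carrier R"
  shows "f \<oplus> g \<in> diff_elems R C"
  using assms(1,2)
proof (induction arbitrary: g rule: diff_elems.induct)
  case zero
  then show ?case by (simp add: diff_elems_closed)
next
  case (step f)
  note g = diff_elems_closed[OF step.prems]
  show ?case
  proof (rule diff_elems.step)
    fix c assume c: "c \<in> C"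
    then show "commutator R (f \<oplus> g) c \<in> diff_elems R C"
      using step.IH[OF c diff_elems_commutator[OF step.prems C c]] step.hyps g C
      by (auto simp: commutator_add subset_iff)
  qed (use step g in auto)
qed

text \<open>Nested induction along the Leibniz rule: in the commutator of
  \<open>f \<otimes> g\<close> with \<open>c\<close>, the summand that differentiates
  \<open>g\<close> falls to the inner induction, the one that differentiates \<open>f\<close> to the
  outer one.\<close>

lemma diff_elems_mult:
  assumes "f \<in> diff_elems R C" "g \<in> diff_elems R C" and C: "C \<subseteq> carrier R"
  shows "f \<otimes> g \<in> diff_elems R C"
  using assms(1,2)
proof (induction arbitrary: g rule: diff_elems.induct)
  case zero
  then show ?case by (simp add: diff_elems_closed diff_elems.zero)
next
  case (step f)
  note IHf = step.IH
  show ?case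
    using step.prems
  proof (induction rule: diff_elems.induct)
    case zero
    then show ?case using step.hyps by (simp add: diff_elems.zero)
  next
    case (step g)
    \<comment> \<open>The outer hypothesis multiplies the commutator of \<open>f\<close> by
      \<open>g\<close> itself, so membership of \<open>g\<close> has to be recovered from that of
      its commutators.\<close>
    have g: "g \<in> diff_elems R C" using step.hyps by (rule diff_elems.step)
    show ?case
    proof (rule diff_elems.step)
      fix c assume c: "c \<in> C"
      then show "commutator R (f \<otimes> g) c \<in> diff_elems R C"
        using diff_elems_add[OF step.IH[OF c] IHf[OF c g] C] \<open>f \<in> carrier R\<close> step.hyps C
        by (auto simp: commutator_mult subset_iff)
    qed (use \<open>f \<in> carrier R\<close> step.hyps in auto)
  qed
qed

lemma diff_elems_subring:
  assumes C: "C \<subseteq> carrier R"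
  shows "subring (diff_elems R C) R"
proof (rule subringI)
  show "\<one> \<in> diff_elems R C"
    using C by (intro diff_elems_commuting) auto
  show "\<ominus> f \<in> diff_elems R C" if f: "f \<in> diff_elems R C" for f
  proof -
    have "\<ominus> \<one> \<in> diff_elems R C"
      using C by (intro diff_elems_commuting) (auto simp: l_minus r_minus subset_iff)
    from diff_elems_mult[OF this f C] show ?thesis
      using diff_elems_closed[OF f] by (simp add: l_minus)
  qed
qed (use C in \<open>auto intro: diff_elems_closed diff_elems_add diff_elems_mult\<close>)

text \<open>Descent: either all commutators of \<open>f\<close> with \<open>C\<close> vanish and
  \<open>f\<close> is the witness, or a nonzero one lies in \<open>I\<close> again and the induction
  hypothesis applies to it.\<close>

lemma exists_commuting_diff_elem:
  assumes "f \<in> diff_elems R C" "f \<in> I" "f \<noteq> \<zero>"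
    and "\<And>g c. \<lbrakk> g \<in> I; c \<in> C \<rbrakk> \<Longrightarrow> commutator R g c \<in> I"
  shows "\<exists>g\<in>I. g \<noteq> \<zero> \<and> (\<forall>c\<in>C. commutator R g c = \<zero>)"
  using assms(1-3)
proof (induction rule: diff_elems.induct)
  case (step f)
  then show ?case using assms(4) by blast
qed simp

text \<open>Subtraction refers to the carrier through the additive inverse, so the two sides do not
  unfold to the same term. The subtraction-free characterization involves only the shared
  operations.\<close>

lemma commutator_subring:
  assumes B: "subring B R" and "f \<in> B" "c \<in> B"
  shows "commutator (R\<lparr>carrier := B\<rparr>) f c = commutator R f c"
proof -
  interpret B: ring "R\<lparr>carrier := B\<rparr>" using B by (rule subring_is_ring)
  have sub: "B \<subseteq> carrier R" using B by (rule subringE(1))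
  have d: "commutator (R\<lparr>carrier := B\<rparr>) f c \<in> B"
    using B.commutator_closed[of f c] assms by simp
  have "f \<otimes> c = commutator (R\<lparr>carrier := B\<rparr>) f c \<oplus> c \<otimes> f"
    using B.commutator_swap[of f c] assms by simp
  then show ?thesis
    using commutator_eq_iff[of f c "commutator (R\<lparr>carrier := B\<rparr>) f c"] sub d assms(2,3)
    by (auto simp: subset_iff)
qed

end

text \<open>Scaling by \<open>a\<close> is multiplication by \<open>a \<odot> \<one>\<close>, which
  is central and thus killed by every commutator.\<close>

lemma (in assoc_algebra) diff_elems_is_subalgebra:
  assumes C: "C \<subseteq> carrier M"
  shows "is_subalgebra (diff_elems M C) R M"
proof -
  have sr: "subring (diff_elems M C) M" using C by (rule A.diff_elems_subring)
  have "submodule (diff_elems M C) R M"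
  proof (rule submoduleI)
    fix a f assume a: "a \<in> carrier R" and f: "f \<in> diff_elems M C"
    have "a \<odot>\<^bsub>M\<^esub> \<one>\<^bsub>M\<^esub> \<in> diff_elems M C"
      using a C by (intro A.diff_elems_commuting)
        (auto simp: smult_mult_left smult_mult_right subset_iff)
    from A.diff_elems_mult[OF this f C] show "a \<odot>\<^bsub>M\<^esub> f \<in> diff_elems M C"
      using a A.diff_elems_closed[OF f] by (simp add: smult_mult_left)
  qed (fact subringE(1)[OF sr] subringE(2)[OF sr] subringE(5)[OF sr] subringE(7)[OF sr])+
  with sr show ?thesis by (simp add: is_subalgebra_def)
qed

lemma generated_subalgebra_least:
  "\<lbrakk> is_subalgebra B K A; S \<subseteq> B \<rbrakk> \<Longrightarrow> generated_subalgebra K A S \<subseteq> B"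
  unfolding generated_subalgebra_def by blast

lemma generated_subalgebra_incl: "S \<subseteq> generated_subalgebra K A S"
  unfolding generated_subalgebra_def by blast

section \<open>Multiplications and Hamiltonian derivations as operators\<close>

context poisson_algebra
begin

abbreviation "E \<equiv> End_algebra K P"
abbreviation "D \<equiv> poisson_diff_ops K P br"

sublocale E: assoc_algebra K E
  by (rule assoc_algebra_End) (rule module)

sublocale D: assoc_algebra K D
  by (rule assoc_algebra_poisson_diff_ops)

lemma E_simps:
  "f \<otimes>\<^bsub>E\<^esub> g = compose (carrier P) f g"
  "f \<oplus>\<^bsub>E\<^esub> g = (\<lambda>x\<in>carrier P. f x \<oplus>\<^bsub>P\<^esub> g x)"
  "\<one>\<^bsub>E\<^esub> = (\<lambda>x\<in>carrier P. x)"
  "\<zero>\<^bsub>E\<^esub> = (\<lambda>x\<in>carrier P. \<zero>\<^bsub>P\<^esub>)"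
  "c \<odot>\<^bsub>E\<^esub> f = (\<lambda>x\<in>carrier P. c \<odot>\<^bsub>P\<^esub> f x)"
  by (simp_all add: End_algebra_def)

lemma D_simps:
  "f \<otimes>\<^bsub>D\<^esub> g = f \<otimes>\<^bsub>E\<^esub> g" "f \<oplus>\<^bsub>D\<^esub> g = f \<oplus>\<^bsub>E\<^esub> g" "\<one>\<^bsub>D\<^esub> = \<one>\<^bsub>E\<^esub>" "\<zero>\<^bsub>D\<^esub> = \<zero>\<^bsub>E\<^esub>"
  by (simp_all add: poisson_diff_ops_def)

lemma D_subalgebra: "is_subalgebra (carrier D) K E"
  using generated_subalgebra_is_subalgebra[OF E.assoc_algebra_axioms poisson_generators_closed]
  by (simp add: poisson_diff_ops_def)

lemma D_subset_E: "carrier D \<subseteq> carrier E"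
  using D_subalgebra by (auto simp: is_subalgebra_def dest: subringE(1))

lemma commutator_D:
  "\<lbrakk> f \<in> carrier D; g \<in> carrier D \<rbrakk> \<Longrightarrow> commutator D f g = commutator E f g"
  using E.A.commutator_subring[of "carrier D" f g] D_subalgebra
  by (simp add: is_subalgebra_def poisson_diff_ops_def)

lemma mult_op_in_D: "a \<in> carrier P \<Longrightarrow> mult_op P a \<in> carrier D"
  and pad_in_D: "a \<in> carrier P \<Longrightarrow> pad P br a \<in> carrier D"
  unfolding poisson_diff_ops_def
  using generated_subalgebra_incl[of "mult_op P ` carrier P \<union> pad P br ` carrier P" K E] by auto

lemma E_apply_closed: "\<lbrakk> f \<in> carrier E; x \<in> carrier P \<rbrakk> \<Longrightarrow> f x \<in> carrier P"
  by (auto simp: End_algebra_def)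

lemma E_eqI:
  assumes "f \<in> carrier E" "g \<in> carrier E" "\<And>x. x \<in> carrier P \<Longrightarrow> f x = g x"
  shows "f = g"
  using assms by (intro extensionalityI[of f "carrier P" g]) (auto simp: End_algebra_def PiE_iff)

lemma mult_op_in_E: "a \<in> carrier P \<Longrightarrow> mult_op P a \<in> carrier E"
  and pad_in_E: "a \<in> carrier P \<Longrightarrow> pad P br a \<in> carrier E"
  using mult_op_in_D pad_in_D D_subset_E by auto

lemma mult_op_mult:
  assumes "a \<in> carrier P" "b \<in> carrier P"
  shows "mult_op P (a \<otimes>\<^bsub>P\<^esub> b) = mult_op P a \<otimes>\<^bsub>E\<^esub> mult_op P b"
  using assms by (auto simp: E_simps mult_op_def compose_def P.m_assoc intro!: restrict_ext)

lemma mult_op_add: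
  assumes "a \<in> carrier P" "b \<in> carrier P"
  shows "mult_op P (a \<oplus>\<^bsub>P\<^esub> b) = mult_op P a \<oplus>\<^bsub>E\<^esub> mult_op P b"
  using assms by (auto simp: E_simps mult_op_def P.l_distr intro!: restrict_ext)

lemma mult_op_zero: "mult_op P \<zero>\<^bsub>P\<^esub> = \<zero>\<^bsub>E\<^esub>"
  by (auto simp: E_simps mult_op_def intro!: restrict_ext)

lemma mult_op_one: "mult_op P \<one>\<^bsub>P\<^esub> = \<one>\<^bsub>E\<^esub>"
  by (auto simp: E_simps mult_op_def intro!: restrict_ext)

text \<open>The Leibniz rule of the bracket read as an operator identity:
  \<open>br b (a \<otimes> x)\<close> minus \<open>a \<otimes> br b x\<close> is
  \<open>br b a \<otimes> x\<close>.\<close>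

lemma commutator_pad_mult_op:
  assumes "a \<in> carrier P" "b \<in> carrier P"
  shows "commutator E (pad P br b) (mult_op P a) = mult_op P (br b a)"
  using assms
  by (subst E.A.commutator_eq_iff)
     (simp_all add: pad_in_E mult_op_in_E br_closed,
      auto simp: br_closed E_simps mult_op_def pad_def compose_def br_leibniz intro!: restrict_ext)

text \<open>It suffices to check generators. Multiplications commute with each other because
  \<open>P\<close> is commutative, and a commutator of \<open>pad\<close> with a multiplication is a
  multiplication.\<close>

lemma D_subset_diff_elems: "carrier D \<subseteq> diff_elems E (mult_op P ` carrier P)"
proof -
  let ?C = "mult_op P ` carrier P"
  have C: "?C \<subseteq> carrier E" using mult_op_in_E by auto
  have mult: "mult_op P a \<in> diff_elems E ?C" if "a \<in> carrier P" for a
    using that C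
    by (intro E.A.diff_elems_commuting)
       (auto simp: mult_op_in_E mult_op_mult[symmetric] P.m_comm)
  have "pad P br a \<in> diff_elems E ?C" if "a \<in> carrier P" for a
    by (rule diff_elems.step) (use that in \<open>auto simp: pad_in_E commutator_pad_mult_op br_closed intro!: mult\<close>)
  with mult have "?C \<union> pad P br ` carrier P \<subseteq> diff_elems E ?C" by blast
  then show ?thesis
    using generated_subalgebra_least[OF E.diff_elems_is_subalgebra[OF C]]
    by (simp add: poisson_diff_ops_def)
qed

text \<open>Such an \<open>f\<close> is \<open>P\<close>-linear, hence determined by its value at
  the unit: \<open>f x = f (x \<otimes> \<one>) = x \<otimes> f \<one>\<close>.\<close>

lemma commuting_eq_mult_op:
  assumes f: "f \<in> carrier E"
    and comm: "\<And>a. a \<in> carrier P \<Longrightarrow> f \<otimes>\<^bsub>E\<^esub> mult_op P a = mult_op P a \<otimes>\<^bsub>E\<^esub> f"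
  shows "f = mult_op P (f \<one>\<^bsub>P\<^esub>)"
proof (rule E_eqI)
  fix x assume x: "x \<in> carrier P"
  have "(f \<otimes>\<^bsub>E\<^esub> mult_op P x) \<one>\<^bsub>P\<^esub> = (mult_op P x \<otimes>\<^bsub>E\<^esub> f) \<one>\<^bsub>P\<^esub>"
    using comm[OF x] by simp
  then show "f x = mult_op P (f \<one>\<^bsub>P\<^esub>) x"
    using x f by (simp add: E_simps compose_def mult_op_def E_apply_closed P.m_comm)
qed (use f in \<open>auto intro: mult_op_in_E E_apply_closed\<close>)

section \<open>From Poisson simplicity to simplicity of \<open>D\<close>\<close>

lemma mult_op_preimage_poisson_ideal:
  assumes I: "ideal I D"
  shows "poisson_ideal {a \<in> carrier P. mult_op P a \<in> I} P br"
proof -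
  interpret I: ideal I D by fact
  let ?J = "{a \<in> carrier P. mult_op P a \<in> I}"
  have mult_left: "b \<otimes>\<^bsub>P\<^esub> a \<in> ?J" if "a \<in> ?J" "b \<in> carrier P" for a b
    using that I.I_l_closed[OF _ mult_op_in_D] by (auto simp: mult_op_mult D_simps)
  have "ideal ?J P"
  proof (rule P.idealI_unital)
    show "\<zero>\<^bsub>P\<^esub> \<in> ?J"
      using I.zero_closed by (simp add: mult_op_zero D_simps)
    show "a \<oplus>\<^bsub>P\<^esub> b \<in> ?J" if "a \<in> ?J" "b \<in> ?J" for a b
      using I.a_closed[of "mult_op P a" "mult_op P b"] that by (simp add: mult_op_add D_simps)
    show "a \<otimes>\<^bsub>P\<^esub> b \<in> ?J" if "a \<in> ?J" "b \<in> carrier P" for a b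
      using mult_left[OF that] that by (simp add: P.m_comm)
  qed (use mult_left in auto)
  moreover have "br b a \<in> ?J" if "b \<in> carrier P" "a \<in> ?J" for a b
  proof -
    have "commutator D (pad P br b) (mult_op P a) \<in> I"
      using D.A.ideal_commutator(2)[OF I] that by (simp add: pad_in_D)
    then show ?thesis
      using that by (simp add: commutator_D pad_in_D mult_op_in_D commutator_pad_mult_op br_closed)
  qed
  ultimately show ?thesis by (simp add: poisson_ideal_def)
qed

lemma poisson_simple_imp_simple:
  assumes simple: "poisson_simple P br"
  shows "simple_algebra K D"
  unfolding simple_algebra_def
proof (intro conjI allI impI D.assoc_algebra_axioms)
  fix I assume "ideal I D"
  then interpret I: ideal I D .
  let ?J = "{a \<in> carrier P. mult_op P a \<in> I}" and ?C = "mult_op P ` carrier P"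
  show "I = {\<zero>\<^bsub>D\<^esub>} \<or> I = carrier D"
  proof (cases "I = {\<zero>\<^bsub>D\<^esub>}")
    case False
    then obtain f where f: "f \<in> I" "f \<noteq> \<zero>\<^bsub>E\<^esub>"
      using I.zero_closed by (auto simp: D_simps)
    \<comment> \<open>The descent runs in \<open>E\<close>, where \<open>diff_elems\<close> is
      formed, while \<open>I\<close> is an ideal of \<open>D\<close>; commutators of elements of
      \<open>D\<close> agree in both.\<close>
    have comm: "commutator E g c \<in> I" if "g \<in> I" "c \<in> ?C" for g c
      using D.A.ideal_commutator(1)[OF I.ideal_axioms, of g c] that I.Icarr
      by (auto simp: mult_op_in_D commutator_D)
    have "f \<in> diff_elems E ?C" using f I.Icarr D_subset_diff_elems by blast
    from E.A.exists_commuting_diff_elem[OF this f comm]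
    obtain g where g: "g \<in> I" "g \<noteq> \<zero>\<^bsub>E\<^esub>" "\<And>c. c \<in> ?C \<Longrightarrow> commutator E g c = \<zero>\<^bsub>E\<^esub>"
      by blast
    have gE: "g \<in> carrier E" using g I.Icarr D_subset_E by blast
    have geq: "g = mult_op P (g \<one>\<^bsub>P\<^esub>)"
      using g(3) gE
      by (intro commuting_eq_mult_op) (auto simp: E.A.commutator_eq_zero_iff[symmetric] mult_op_in_E)
    have "g \<one>\<^bsub>P\<^esub> \<in> ?J"
      using geq g(1) E_apply_closed[OF gE] by auto
    \<comment> \<open>Otherwise \<open>g\<close> would be multiplication by zero.\<close>
    moreover have "g \<one>\<^bsub>P\<^esub> \<noteq> \<zero>\<^bsub>P\<^esub>"
      using geq g(2) mult_op_zero by metis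
    ultimately have "?J = carrier P"
      using simple mult_op_preimage_poisson_ideal[OF I.ideal_axioms]
      unfolding poisson_simple_def by blast
    then have "\<one>\<^bsub>D\<^esub> \<in> I"
      using P.one_closed by (auto simp: mult_op_one[symmetric] D_simps)
    then show ?thesis using I.one_imp_carrier by blast
  qed simp
qed

section \<open>From simplicity of \<open>D\<close> to Poisson simplicity\<close>

text \<open>The operators that map \<open>J\<close> into itself form a subalgebra of
  \<open>E\<close>. It contains the multiplications because \<open>J\<close> is an ideal and each
  \<open>pad\<close> because \<open>J\<close> is stable under the bracket.\<close>

lemma D_preserves_poisson_ideal:
  assumes J: "poisson_ideal J P br" and f: "f \<in> carrier D" and x: "x \<in> J"
  shows "f x \<in> J"
proof -
  interpret J: ideal J P using J by (simp add: poisson_ideal_def)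
  let ?B = "{f \<in> carrier E. \<forall>x\<in>J. f x \<in> J}"
  \<comment> \<open>Ideals are only assumed closed under ring multiplication; the unit turns scaling
    by \<open>c\<close> into multiplication by \<open>c \<odot> \<one>\<close>.\<close>
  have smult: "c \<odot>\<^bsub>P\<^esub> y \<in> J" if "c \<in> carrier K" "y \<in> J" for c y
    using J.I_l_closed[OF that(2), of "c \<odot>\<^bsub>P\<^esub> \<one>\<^bsub>P\<^esub>"] that J.Icarr
    by (simp add: P.smult_assoc2)
  have smultB: "c \<odot>\<^bsub>E\<^esub> g \<in> ?B" if "c \<in> carrier K" "g \<in> ?B" for c g
    using that smult J.Icarr by (auto simp: E_simps(5) intro: E.smult_closed[unfolded E_simps])
  have sr: "subring ?B E"
  proof (rule E.A.subringI)
    show "\<ominus>\<^bsub>E\<^esub> g \<in> ?B" if "g \<in> ?B" for g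
      using smultB[OF _ that, of "\<ominus>\<^bsub>K\<^esub> \<one>\<^bsub>K\<^esub>"] that by (simp add: E.smult_l_minus)
    show "g \<otimes>\<^bsub>E\<^esub> h \<in> ?B" if "g \<in> ?B" "h \<in> ?B" for g h
      using that J.Icarr E.A.m_closed[of g h] by (auto simp: E_simps compose_def)
    show "g \<oplus>\<^bsub>E\<^esub> h \<in> ?B" if "g \<in> ?B" "h \<in> ?B" for g h
      using that J.Icarr E.a_closed[of g h] by (auto simp: E_simps)
    show "\<one>\<^bsub>E\<^esub> \<in> ?B"
      using J.Icarr E.A.one_closed by (auto simp: E_simps)
  qed auto
  have "submodule ?B K E"
    by (rule E.submoduleI)
       (fact smultB subringE(1)[OF sr] subringE(2)[OF sr] subringE(5)[OF sr] subringE(7)[OF sr])+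
  with sr have "is_subalgebra ?B K E" by (simp add: is_subalgebra_def)
  moreover have "mult_op P ` carrier P \<union> pad P br ` carrier P \<subseteq> ?B"
    using J J.Icarr J.I_l_closed mult_op_in_E pad_in_E
    by (auto simp: mult_op_def pad_def poisson_ideal_def)
  ultimately have "carrier D \<subseteq> ?B"
    unfolding poisson_diff_ops_def by (simp add: generated_subalgebra_least)
  with f x show ?thesis by blast
qed

text \<open>Composing with \<open>g\<close> on the right only restricts the arguments of
  \<open>f\<close>; composing on the left stays inside \<open>J\<close> because operators in
  \<open>D\<close> preserve \<open>J\<close>.\<close>

lemma image_in_poisson_ideal_ideal:
  assumes J: "poisson_ideal J P br"
  shows "ideal {f \<in> carrier D. \<forall>x\<in>carrier P. f x \<in> J} D"
proof -
  interpret J: ideal J P using J by (simp add: poisson_ideal_def)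
  let ?I = "{f \<in> carrier D. \<forall>x\<in>carrier P. f x \<in> J}"
  show ?thesis
  proof (rule D.A.idealI_unital)
    show "\<zero>\<^bsub>D\<^esub> \<in> ?I"
      using D.zero_closed by (auto simp: D_simps E_simps)
    show "f \<oplus>\<^bsub>D\<^esub> g \<in> ?I" if "f \<in> ?I" "g \<in> ?I" for f g
      using that D.a_closed[of f g] by (auto simp: D_simps E_simps)
    show "g \<otimes>\<^bsub>D\<^esub> f \<in> ?I" if "f \<in> ?I" "g \<in> carrier D" for f g
      using that D.A.m_closed[of g f] D_preserves_poisson_ideal[OF J]
      by (auto simp: D_simps E_simps compose_def)
    show "f \<otimes>\<^bsub>D\<^esub> g \<in> ?I" if "f \<in> ?I" "g \<in> carrier D" for f g
      using that D.A.m_closed[of f g] E_apply_closed[of g] D_subset_E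
      by (auto simp: D_simps E_simps compose_def)
  qed auto
qed

text \<open>The ideal of operators with image in \<open>J\<close> detects both extremes of
  \<open>J\<close>: it contains multiplication by each \<open>a\<close> in \<open>J\<close>, whose
  value at the unit is \<open>a\<close>, and if it contains the identity then the unit lies in
  \<open>J\<close>.\<close>

lemma simple_imp_poisson_simple:
  assumes simple: "simple_algebra K D"
  shows "poisson_simple P br"
  unfolding poisson_simple_def
proof (intro allI impI)
  fix J assume J: "poisson_ideal J P br"
  interpret J: ideal J P using J by (simp add: poisson_ideal_def)
  let ?I = "{f \<in> carrier D. \<forall>x\<in>carrier P. f x \<in> J}"
  have "?I = {\<zero>\<^bsub>D\<^esub>} \<or> ?I = carrier D"
    using simple image_in_poisson_ideal_ideal[OF J] unfolding simple_algebra_def by blast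
  then show "J = {\<zero>\<^bsub>P\<^esub>} \<or> J = carrier P"
  proof
    assume I: "?I = {\<zero>\<^bsub>D\<^esub>}"
    have "a = \<zero>\<^bsub>P\<^esub>" if a: "a \<in> J" for a
    proof -
      have "mult_op P a \<in> ?I"
        using a J.I_r_closed mult_op_in_D J.Icarr by (auto simp: mult_op_def)
      then have "mult_op P a \<one>\<^bsub>P\<^esub> = \<zero>\<^bsub>E\<^esub> \<one>\<^bsub>P\<^esub>" using I by (simp add: D_simps)
      then show ?thesis using a J.Icarr by (simp add: mult_op_def E_simps)
    qed
    then show ?thesis using J.zero_closed by blast
  next
    assume "?I = carrier D"
    then have "\<one>\<^bsub>D\<^esub> \<in> ?I" using D.A.one_closed by blast
    then have "\<one>\<^bsub>P\<^esub> \<in> J" by (auto simp: D_simps E_simps)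
    then show ?thesis using J.one_imp_carrier by blast
  qed
qed

end

theorem theorem1p1:
  fixes K :: "('k, 'm) ring_scheme"
    and P :: "('k, 'p, 'n) module_scheme"
    and br :: "'p \<Rightarrow> 'p \<Rightarrow> 'p"
  assumes "poisson_algebra K P br"
  shows "simple_algebra K (poisson_diff_ops K P br) \<longleftrightarrow> poisson_simple P br"
  using assms poisson_algebra.simple_imp_poisson_simple poisson_algebra.poisson_simple_imp_simple
  by blast

end
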